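(* Consider the block Gibbs sampler defined in the context in the balanced case, i.e. $m_i=m\ge2$ for all $i=1,\ldots,K$, with $K\ge3$. Let $$\delta_1=\frac{1}{2a_1+K-2},\quad \delta_2=\frac{1}{2a_2+M-2},\quad \delta_3=(K+1)\delta_2,\quad \delta_5=K\delta_2,\quad \delta=\max\{\delta_1,\delta_3\},$$ $$c_1=\frac{2b_1}{2a_1+K-2},\qquad c_2=\frac{2b_2+\mathrm{SSE}}{2a_2+M-2}.$$ Fix $\gamma\in(\delta,1)$ and let $\phi$ be a positive number such that $\phi\delta_5+\delta<\gamma$. Define $V_2(\theta,\mu)=\phi v_1(\theta,\mu)+m^{-1}v_2(\theta)$. Then, for every current state $(\lambda',\theta',\mu')\in\mathbb{R}_+^2\times\mathbb{R}^K\times\mathbb{R}$, the next state $(\lambda,\theta,\mu)$ of the block Gibbs sampler satisfies $$E[V_2(\theta,\mu)\mid\lambda',\theta',\mu']\le\gamma V_2(\theta',\mu')+b,$$ where $$b=\phi c_1+\frac{\phi K+K+1}{m}\,c_2+\max\{\phi,1\}\sum_{i=1}^K\max\{(\bar y-\bar y_i)^2,(m_0-\bar y_i)^2\},\qquad \bar y=K^{-1}\sum_{i=1}^K\bar y_i.$$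
   Context: Model. $K$ and $m_1,\ldots,m_K$ are positive integers, $M=\sum_{i=1}^K m_i$, and $y=(y_{ij})$, $1\le i\le K$, $1\le j\le m_i$, is fixed real data. $a_1,b_1,a_2,b_2,s_0$ are known positive constants and $m_0\in\mathbb{R}$ is known. $\mathrm{Gamma}(\alpha,\beta)$ has density proportional to $w^{\alpha-1}e^{-w\beta}I(w>0)$. Hierarchical model: given $\theta=(\theta_1,\ldots,\theta_K)^T$ and $\lambda_e$, the $Y_{ij}$ are independent with $Y_{ij}\sim\mathrm{N}(\theta_i,\lambda_e^{-1})$; given $\mu,\lambda_\theta$, the variables $\theta_1,\ldots,\theta_K,\lambda_e$ are independent with $\theta_i\sim\mathrm{N}(\mu,\lambda_\theta^{-1})$ and $\lambda_e\sim\mathrm{Gamma}(a_2,b_2)$; $\mu\sim\mathrm{N}(m_0,s_0^{-1})$ and $\lambda_\theta\sim\mathrm{Gamma}(a_1,b_1)$ are independent. Write $\lambda=(\lambda_\theta,\lambda_e)^T$ and $\xi=(\theta_1,\ldots,\theta_K,\mu)^T$. The posterior is the conditional distribution of $(\theta,\mu,\lambda)$ given $Y=y$. Notation: $\bar y_i=m_i^{-1}\sum_{j}y_{ij}$, $\mathrm{SSE}=\sum_{i,j}(y_{ij}-\bar y_i)^2$, $v_1(\theta,\mu)=\sum_{i=1}^K(\theta_i-\mu)^2$, $v_2(\theta)=\sum_{i=1}^K m_i(\theta_i-\bar y_i)^2$. Block Gibbs sampler. The Markov chain on $(\lambda,\xi)\in\mathbb{R}_+^2\times\mathbb{R}^{K+1}$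 whose transition $(\lambda',\xi')\to(\lambda,\xi)$ has density $k(\lambda,\xi\mid\lambda',\xi')=f(\lambda_\theta\mid\xi',y)f(\lambda_e\mid\xi',y)f(\xi\mid\lambda,y)$, where the $f$'s are the posterior conditional densities: $\lambda_\theta\mid\xi,y\sim\mathrm{Gamma}\left(\frac K2+a_1,\frac{v_1(\theta,\mu)}2+b_1\right)$, $\lambda_e\mid\xi,y\sim\mathrm{Gamma}\left(\frac M2+a_2,\frac{v_2(\theta)+\mathrm{SSE}}2+b_2\right)$, and $\xi\mid\lambda,y$ is multivariate normal with, for $t=\sum_{i=1}^K\frac{m_i\lambda_\theta\lambda_e}{\lambda_\theta+m_i\lambda_e}$, $E(\mu\mid\lambda)=\frac1{s_0+t}\left[\sum_{i=1}^K\frac{m_i\lambda_\theta\lambda_e\bar y_i}{\lambda_\theta+m_i\lambda_e}+m_0s_0\right]$, $E(\theta_i\mid\lambda)=\frac{\lambda_\theta E(\mu\mid\lambda)+m_i\lambda_e\bar y_i}{\lambda_\theta+m_i\lambda_e}$, $\mathrm{Var}(\mu\mid\lambda)=\frac1{s_0+t}$, $\mathrm{Var}(\theta_i\mid\lambda)=\frac1{\lambda_\theta+m_i\lambda_e}\left[1+\frac{\lambda_\theta^2}{(\lambda_\theta+m_i\lambda_e)(s_0+t)}\right]$, $\mathrm{Cov}(\theta_i,\mu\mid\lambda)=\frac{\lambda_\theta}{(\lambda_\theta+m_i\lambda_e)(s_0+t)}$, $\mathrm{Cov}(\theta_i,\theta_j\mid\lambda)=\frac{\lambda_\theta^2}{(\lambda_\theta+m_i\lambda_e)(\lambda_\theta+m_j\lambda_e)(s_0+t)}$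 for $i\ne j$. *)

theory Defs
  imports "HOL-Probability.Probability"
begin

text \<open>Shape \<open>\<alpha>\<close> and rate \<open>\<beta>\<close>; \<open>Gamma\<close> on the right-hand side is Euler's function, which
  supplies the normalising constant.\<close>

definition gamma_density :: "real \<Rightarrow> real \<Rightarrow> real \<Rightarrow> real" where
  "gamma_density \<alpha> \<beta> w =
     (if w > 0 then \<beta> powr \<alpha> / Gamma \<alpha> * w powr (\<alpha> - 1) * exp (- (w * \<beta>)) else 0)"

text \<open>Density with respect to Lebesgue measure, meaningful for positive definite \<open>\<Sigma>\<close>.\<close>

definition mvn_density :: "real^'n \<Rightarrow> real^'n^'n \<Rightarrow> real^'n \<Rightarrow> real" where
  "mvn_density \<nu> \<Sigma> x =
     exp (- ((x - \<nu>) \<bullet> (matrix_inv \<Sigma> *v (x - \<nu>))) / 2) / sqrt ((2 * pi) ^ CARD('n) * det \<Sigma>)"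

text \<open>The groups are indexed by a finite type \<open>'k\<close>, so \<open>K = CARD('k)\<close>. Group \<open>i\<close> has the
  observations \<open>y i j\<close> for \<open>1 \<le> j \<le> m i\<close>; values of \<open>y i\<close> outside that range are never used.\<close>

definition total_obs :: "('k::finite \<Rightarrow> nat) \<Rightarrow> nat" where
  "total_obs m = (\<Sum>i\<in>UNIV. m i)"

definition group_mean :: "('k::finite \<Rightarrow> nat) \<Rightarrow> ('k \<Rightarrow> nat \<Rightarrow> real) \<Rightarrow> 'k \<Rightarrow> real" where
  "group_mean m y i = (\<Sum>j=1..m i. y i j) / m i"

definition SSE :: "('k::finite \<Rightarrow> nat) \<Rightarrow> ('k \<Rightarrow> nat \<Rightarrow> real) \<Rightarrow> real" where
  "SSE m y = (\<Sum>i\<in>UNIV. \<Sum>j=1..m i. (y i j - group_mean m y i)\<^sup>2)"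

definition v1 :: "real^'k \<Rightarrow> real \<Rightarrow> real" where
  "v1 \<theta> \<mu> = (\<Sum>i\<in>UNIV. (\<theta> $ i - \<mu>)\<^sup>2)"

definition v2 :: "('k::finite \<Rightarrow> nat) \<Rightarrow> ('k \<Rightarrow> nat \<Rightarrow> real) \<Rightarrow> real^'k \<Rightarrow> real" where
  "v2 m y \<theta> = (\<Sum>i\<in>UNIV. m i * (\<theta> $ i - group_mean m y i)\<^sup>2)"

text \<open>The vector \<open>\<xi> = (\<theta>\<^sub>1, \<dots>, \<theta>\<^sub>K, \<mu>)\<close> is an element of \<open>real^('k option)\<close>: coordinate
  \<open>Some i\<close> holds \<open>\<theta>\<^sub>i\<close> and coordinate \<open>None\<close> holds \<open>\<mu>\<close>.\<close>

definition theta_of :: "real^('k::finite option) \<Rightarrow> real^'k" where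
  "theta_of \<xi> = (\<chi> i. \<xi> $ Some i)"

definition mu_of :: "real^('k::finite option) \<Rightarrow> real" where
  "mu_of \<xi> = \<xi> $ None"

text \<open>Throughout, \<open>lt\<close> and \<open>le\<close> stand for \<open>\<lambda>\<^sub>\<theta>\<close> and \<open>\<lambda>\<^sub>e\<close>.\<close>

definition lambda_theta_density ::
  "real \<Rightarrow> real \<Rightarrow> real^('k::finite option) \<Rightarrow> real \<Rightarrow> real" where
  "lambda_theta_density a1 b1 \<xi> lt =
     gamma_density (real CARD('k) / 2 + a1) (v1 (theta_of \<xi>) (mu_of \<xi>) / 2 + b1) lt"

definition lambda_e_density ::
  "('k::finite \<Rightarrow> nat) \<Rightarrow> ('k \<Rightarrow> nat \<Rightarrow> real) \<Rightarrow> real \<Rightarrow> real \<Rightarrow> real^('k option) \<Rightarrow> real \<Rightarrow> real" where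
  "lambda_e_density m y a2 b2 \<xi> le =
     gamma_density (real (total_obs m) / 2 + a2) ((v2 m y (theta_of \<xi>) + SSE m y) / 2 + b2) le"

definition t_sum :: "('k::finite \<Rightarrow> nat) \<Rightarrow> real \<times> real \<Rightarrow> real" where
  "t_sum m = (\<lambda>(lt, le). \<Sum>i\<in>UNIV. m i * lt * le / (lt + m i * le))"

definition mu_mean ::
  "('k::finite \<Rightarrow> nat) \<Rightarrow> ('k \<Rightarrow> nat \<Rightarrow> real) \<Rightarrow> real \<Rightarrow> real \<Rightarrow> real \<times> real \<Rightarrow> real" where
  "mu_mean m y s0 m0 = (\<lambda>(lt, le).
     1 / (s0 + t_sum m (lt, le)) *
       ((\<Sum>i\<in>UNIV. m i * lt * le * group_mean m y i / (lt + m i * le)) + m0 * s0))"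

definition xi_mean ::
  "('k::finite \<Rightarrow> nat) \<Rightarrow> ('k \<Rightarrow> nat \<Rightarrow> real) \<Rightarrow> real \<Rightarrow> real \<Rightarrow> real \<times> real \<Rightarrow> real^('k option)" where
  "xi_mean m y s0 m0 = (\<lambda>(lt, le). \<chi> p. case p of
       None \<Rightarrow> mu_mean m y s0 m0 (lt, le)
     | Some i \<Rightarrow> (lt * mu_mean m y s0 m0 (lt, le) + m i * le * group_mean m y i) / (lt + m i * le))"

definition xi_cov ::
  "('k::finite \<Rightarrow> nat) \<Rightarrow> real \<Rightarrow> real \<times> real \<Rightarrow> real^('k option)^('k option)" where
  "xi_cov m s0 = (\<lambda>(lt, le). let t = t_sum m (lt, le) in \<chi> p q. case (p, q) of
       (None, None) \<Rightarrow> 1 / (s0 + t)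
     | (Some i, None) \<Rightarrow> lt / ((lt + m i * le) * (s0 + t))
     | (None, Some i) \<Rightarrow> lt / ((lt + m i * le) * (s0 + t))
     | (Some i, Some j) \<Rightarrow>
         (if i = j then 1 / (lt + m i * le) * (1 + lt\<^sup>2 / ((lt + m i * le) * (s0 + t)))
          else lt\<^sup>2 / ((lt + m i * le) * (lt + m j * le) * (s0 + t))))"

definition xi_density ::
  "('k::finite \<Rightarrow> nat) \<Rightarrow> ('k \<Rightarrow> nat \<Rightarrow> real) \<Rightarrow> real \<Rightarrow> real \<Rightarrow>
   real \<times> real \<Rightarrow> real^('k option) \<Rightarrow> real" where
  "xi_density m y s0 m0 lam \<xi> = mvn_density (xi_mean m y s0 m0 lam) (xi_cov m s0 lam) \<xi>"

text \<open>The first state argument is the current state, the second the next state. The density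
  vanishes unless both precisions of the next state are positive, so the chain lives on
  \<open>\<real>\<^sub>+\<^sup>2 \<times> \<real>\<^sup>K\<^sup>+\<^sup>1\<close>.\<close>

definition block_gibbs_density ::
  "('k::finite \<Rightarrow> nat) \<Rightarrow> ('k \<Rightarrow> nat \<Rightarrow> real) \<Rightarrow> real \<Rightarrow> real \<Rightarrow> real \<Rightarrow> real \<Rightarrow> real \<Rightarrow> real \<Rightarrow>
   (real \<times> real) \<times> (real^('k option)) \<Rightarrow> (real \<times> real) \<times> (real^('k option)) \<Rightarrow> real" where
  "block_gibbs_density m y a1 b1 a2 b2 s0 m0 = (\<lambda>(lam', \<xi>') ((lt, le), \<xi>).
     lambda_theta_density a1 b1 \<xi>' lt * lambda_e_density m y a2 b2 \<xi>' le *
     xi_density m y s0 m0 (lt, le) \<xi>)"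

definition block_gibbs_step ::
  "('k::finite \<Rightarrow> nat) \<Rightarrow> ('k \<Rightarrow> nat \<Rightarrow> real) \<Rightarrow> real \<Rightarrow> real \<Rightarrow> real \<Rightarrow> real \<Rightarrow> real \<Rightarrow> real \<Rightarrow>
   (real \<times> real) \<times> (real^('k option)) \<Rightarrow> ((real \<times> real) \<times> (real^('k option))) measure" where
  "block_gibbs_step m y a1 b1 a2 b2 s0 m0 s =
     density lborel (\<lambda>s'. ennreal (block_gibbs_density m y a1 b1 a2 b2 s0 m0 s s'))"

end

theory Submission
  imports Defs
begin

text \<open>
  Completing the square in the normal density shows that, given the precisions, \<open>\<mu>\<close> is normal and,
  given \<open>\<mu>\<close>, the \<open>\<theta>\<^sub>i\<close> are independent normals; hence with \<open>u = \<lambda>\<^sub>\<theta>\<close>, \<open>e = m\<lambda>\<^sub>e\<close>, \<open>d = u + e\<close>,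
  \<open>s = s\<^sub>0 + t\<close> and \<open>\<nu> = E(\<mu>|\<lambda>)\<close>, the conditional expectation of \<open>(\<theta>\<^sub>i - \<mu>)\<^sup>2\<close> is
  \<open>1/d + (e/d)\<^sup>2 (1/s + (\<nu> - ybar\<^sub>i)\<^sup>2)\<close> and that of \<open>(\<theta>\<^sub>i - ybar\<^sub>i)\<^sup>2\<close> is
  \<open>1/d + (u/d)\<^sup>2 (1/s + (\<nu> - ybar\<^sub>i)\<^sup>2)\<close>. Since \<open>s \<ge> t = Kue/d\<close> and \<open>\<nu>\<close> is a weighted mean of \<open>ybar\<close>
  and \<open>m\<^sub>0\<close>, the conditional expectation of \<open>V\<^sub>2\<close> is at most \<open>\<phi>/u + (\<phi>K + K + 1)/e\<close> plus a constant,
  and \<open>E(1/w) = \<beta>/(\<alpha> - 1)\<close> for \<open>w \<sim> Gamma(\<alpha>, \<beta>)\<close> finishes the computation.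
\<close>

section \<open>Gamma densities: total mass and the mean of the reciprocal\<close>

text \<open>The substitution \<open>w = x / \<beta>\<close> absorbs the rate and leaves Euler's
  integral for \<open>Gamma \<alpha>\<close>.\<close>

lemma nn_integral_gamma_density:
  assumes "\<alpha> > 0" "\<beta> > 0"
  shows "(\<integral>\<^sup>+w. ennreal (gamma_density \<alpha> \<beta> w) \<partial>lborel) = 1"
proof -
  have "(\<integral>\<^sup>+w. ennreal (gamma_density \<alpha> \<beta> w) \<partial>lborel)
      = ennreal (1 / \<beta>) * (\<integral>\<^sup>+x. ennreal (gamma_density \<alpha> \<beta> (0 + 1 / \<beta> * x)) \<partial>lborel)"
    using assms by (subst nn_integral_real_affine[where t = 0 and c = "1 / \<beta>"])
      (auto simp: gamma_density_def)
  also have "(\<integral>\<^sup>+x. ennreal (gamma_density \<alpha> \<beta> (0 + 1 / \<beta> * x)) \<partial>lborel)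
      = (\<integral>\<^sup>+x. ennreal (\<beta> / Gamma \<alpha>) *
           ennreal (indicator {0..} x * x powr (\<alpha> - 1) / exp x) \<partial>lborel)"
  proof (rule nn_integral_cong)
    fix x :: real
    \<comment> \<open>At \<open>x = 0\<close> the left side vanishes by definition and the right
      side because \<open>0 powr a = 0\<close>, so the closed indicator does no harm.\<close>
    show "ennreal (gamma_density \<alpha> \<beta> (0 + 1 / \<beta> * x)) = ennreal (\<beta> / Gamma \<alpha>) *
        ennreal (indicator {0..} x * x powr (\<alpha> - 1) / exp x)"
      using assms Gamma_real_pos[of \<alpha>]
      by (auto simp: gamma_density_def ennreal_mult'[symmetric] powr_divide powr_diff
          exp_minus field_simps indicator_def zero_less_divide_iff)
  qed
  also have "\<dots> = ennreal (\<beta> / Gamma \<alpha>) * ennreal (Gamma \<alpha>)"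
    using assms by (simp add: nn_integral_cmult Gamma_conv_nn_integral_real)
  also have "ennreal (1 / \<beta>) * \<dots> = 1"
    using assms Gamma_real_pos[OF assms(1)] by (simp add: ennreal_mult'[symmetric] less_imp_neq[THEN not_sym])
  finally show ?thesis .
qed

lemma gamma_density_nonneg:
  assumes "\<alpha> > 0"
  shows "gamma_density \<alpha> \<beta> w \<ge> 0"
  using assms Gamma_real_pos[of \<alpha>] by (auto simp: gamma_density_def)

lemma borel_measurable_gamma_density [measurable]: "gamma_density \<alpha> \<beta> \<in> borel_measurable borel"
  unfolding gamma_density_def by measurable

text \<open>Dividing by \<open>w\<close> lowers the shape by one, and the functional equation of the
  Gamma function adjusts the normalising constant. The mean of \<open>1 / w\<close> thereby becomes
  a total mass; \<alpha> > 1 keeps the lowered shape positive.\<close>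

lemma gamma_density_divide:
  assumes "\<alpha> > 1" "\<beta> > 0"
  shows "gamma_density \<alpha> \<beta> w / w = \<beta> / (\<alpha> - 1) * gamma_density (\<alpha> - 1) \<beta> w"
proof -
  have eq: "Gamma \<alpha> = (\<alpha> - 1) * Gamma (\<alpha> - 1)"
    using Gamma_plus1[of "\<alpha> - 1"] assms by (auto simp: nonpos_Ints_def)
  then show ?thesis
    using assms Gamma_real_pos[of "\<alpha> - 1"]
    by (auto simp: gamma_density_def powr_diff power2_eq_square divide_simps)
qed

lemma nn_integral_gamma_density_inverse:
  assumes "\<alpha> > 1" "\<beta> > 0"
  shows "(\<integral>\<^sup>+w. ennreal (gamma_density \<alpha> \<beta> w / w) \<partial>lborel) = ennreal (\<beta> / (\<alpha> - 1))"
  using assms nn_integral_gamma_density[of "\<alpha> - 1" \<beta>]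
  by (simp add: gamma_density_divide ennreal_mult' gamma_density_nonneg nn_integral_cmult
      del: times_divide_eq_left)

section \<open>Second moments of affine functions of a normal variable\<close>

lemma nn_integral_normal_density:
  assumes "\<sigma> > 0"
  shows "(\<integral>\<^sup>+x. ennreal (normal_density \<nu> \<sigma> x) \<partial>lborel) = 1"
  using assms by (simp add: nn_integral_eq_integral normal_density_nonneg)

text \<open>Write \<open>r * x + c = r * (x - \<nu>) + (r * \<nu> + c)\<close>. After expanding the
  square, the cross term has integral 0 and the other two give variance plus squared mean.\<close>

lemma nn_integral_normal_density_square:
  assumes "\<sigma> > 0"
  shows "(\<integral>\<^sup>+x. ennreal ((r * x + c)\<^sup>2 * normal_density \<nu> \<sigma> x) \<partial>lborel)
    = ennreal (r\<^sup>2 * \<sigma>\<^sup>2 + (r * \<nu> + c)\<^sup>2)"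
proof -
  have 0: "has_bochner_integral lborel (\<lambda>x. normal_density \<nu> \<sigma> x) 1"
    using assms normal_moment_even[of \<sigma> \<nu> 0] by simp
  have 1: "has_bochner_integral lborel (\<lambda>x. normal_density \<nu> \<sigma> x * (x - \<nu>)) 0"
    using assms normal_moment_odd[of \<sigma> \<nu> 0] by simp
  have 2: "has_bochner_integral lborel (\<lambda>x. normal_density \<nu> \<sigma> x * (x - \<nu>)\<^sup>2) (\<sigma>\<^sup>2)"
    using assms normal_moment_even[of \<sigma> \<nu> 1] by simp
  have "has_bochner_integral lborel (\<lambda>x. r\<^sup>2 * (normal_density \<nu> \<sigma> x * (x - \<nu>)\<^sup>2)
      + (2 * r * (r * \<nu> + c) * (normal_density \<nu> \<sigma> x * (x - \<nu>)) + (r * \<nu> + c)\<^sup>2 * normal_density \<nu> \<sigma> x))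
     (r\<^sup>2 * \<sigma>\<^sup>2 + (2 * r * (r * \<nu> + c) * 0 + (r * \<nu> + c)\<^sup>2 * 1))"
    by (intro has_bochner_integral_add has_bochner_integral_mult_right 0 1 2)
  moreover have "r\<^sup>2 * (normal_density \<nu> \<sigma> x * (x - \<nu>)\<^sup>2)
      + (2 * r * (r * \<nu> + c) * (normal_density \<nu> \<sigma> x * (x - \<nu>)) + (r * \<nu> + c)\<^sup>2 * normal_density \<nu> \<sigma> x)
      = (r * x + c)\<^sup>2 * normal_density \<nu> \<sigma> x" for x
    by (simp add: power2_eq_square algebra_simps)
  ultimately have "has_bochner_integral lborel (\<lambda>x. (r * x + c)\<^sup>2 * normal_density \<nu> \<sigma> x)
      (r\<^sup>2 * \<sigma>\<^sup>2 + (r * \<nu> + c)\<^sup>2)"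
    by simp
  then show ?thesis
    by (simp add: nn_integral_eq_integral normal_density_nonneg has_bochner_integral_iff)
qed

section \<open>Lebesgue measure on vectors as a product measure\<close>

lemma borel_measurable_vec_lambda:
  assumes "\<And>i. (\<lambda>x. f x i) \<in> borel_measurable M"
  shows "(\<lambda>x. (\<chi> i. f x i) :: real^'n::finite) \<in> borel_measurable M"
  using assms by (subst borel_measurable_euclidean_space) (auto simp: Basis_vec_def inner_axis)

text \<open>Both measures give a box the product of its side lengths, and these values characterise
  \<open>lborel\<close>. The identity allows \<xi> to be integrated coordinate by
  coordinate.\<close>

lemma lborel_vec_eq_distr_PiM:
  "(lborel :: (real^'n::finite) measure) = distr (\<Pi>\<^sub>M i\<in>UNIV. lborel) borel (\<lambda>f. \<chi> i. f i)"
proof (rule lborel_eqI)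
  interpret product_sigma_finite "\<lambda>_::'n. lborel :: real measure" ..
  have meas [measurable]: "(\<lambda>f. \<chi> i. f i) \<in> measurable (\<Pi>\<^sub>M i\<in>(UNIV::'n set). (lborel::real measure)) borel"
    by (rule borel_measurable_vec_lambda) simp
  fix l u :: "real^'n"
  assume "\<And>b. b \<in> Basis \<Longrightarrow> l \<bullet> b \<le> u \<bullet> b"
  then have le: "l $ i \<le> u $ i" for i
    by (metis axis_in_Basis_iff Basis_real_def cart_eq_inner_axis insertI1)
  have "(\<lambda>f. \<chi> i. f i) -` box l u \<inter> space (\<Pi>\<^sub>M i\<in>UNIV. lborel) = Pi\<^sub>E UNIV (\<lambda>i. {l $ i <..< u $ i})"
    by (auto simp: space_PiM mem_box_cart PiE_iff)
  then have "emeasure (distr (\<Pi>\<^sub>M i\<in>UNIV. lborel) borel (\<lambda>f. \<chi> i. f i)) (box l u)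
      = (\<Prod>i\<in>UNIV. ennreal (u $ i - l $ i))"
    using le by (simp add: emeasure_distr emeasure_PiM)
  also have "\<dots> = ennreal (\<Prod>i\<in>UNIV. u $ i - l $ i)"
    using le by (intro prod_ennreal) auto
  also have "(\<Prod>i\<in>UNIV. u $ i - l $ i) = (\<Prod>b\<in>Basis. (u - l) \<bullet> b)"
  proof -
    have "(\<Prod>b\<in>Basis. (u - l) \<bullet> b) = (\<Prod>b\<in>range (\<lambda>i. axis i 1). (u - l) \<bullet> b)"
      by (rule prod.cong) (auto simp: Basis_vec_def)
    also have "\<dots> = (\<Prod>i\<in>UNIV. u $ i - l $ i)"
      by (subst prod.reindex) (auto simp: inj_def axis_eq_axis inner_axis)
    finally show ?thesis ..
  qed
  finally show "emeasure (distr (\<Pi>\<^sub>M i\<in>UNIV. lborel) borel (\<lambda>f. \<chi> i. f i)) (box l u)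
      = ennreal (\<Prod>b\<in>Basis. (u - l) \<bullet> b)" .
qed simp

section \<open>Multivariate normal densities in standardised coordinates\<close>

lemma matrix_mult_matrix_inv:
  assumes "invertible A"
  shows "A ** matrix_inv A = mat 1"
  using assms someI_ex[of "\<lambda>A'. A ** A' = mat 1 \<and> A' ** A = mat 1"]
  unfolding invertible_def matrix_inv_def by blast

text \<open>A square root \<open>L\<close> of the covariance turns the quadratic form into
  \<open>z \<bullet> z\<close> and the root of the determinant into
  \<open>\<bar>det L\<bar>\<close>. Neither the inverse nor the determinant of the covariance then
  has to be computed entry by entry.\<close>

lemma mvn_density_affine:
  fixes L :: "real^'n^'n"
  assumes "invertible L"
  shows "mvn_density \<nu> (L ** transpose L) (\<nu> + L *v z)
    = (\<Prod>i\<in>UNIV. std_normal_density (z $ i)) / \<bar>det L\<bar>"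
proof -
  let ?S = "L ** transpose L" and ?w = "matrix_inv (L ** transpose L) *v (L *v z)"
  have invS: "invertible ?S"
    using assms by (simp add: invertible_mult transpose_invertible)
  \<comment> \<open>\<open>?w\<close> solves \<open>?S *v ?w = L *v z\<close>; injectivity of
    \<open>L\<close> cancels the outer factor, and moving \<open>L\<close> across the inner product
    gives the quadratic form.\<close>
  have "L *v (transpose L *v ?w) = L *v z"
    by (metis matrix_mult_matrix_inv[OF invS] matrix_vector_mul_assoc matrix_vector_mul_lid)
  then have "transpose L *v ?w = z"
    using inj_matrix_vector_mult[OF assms] by (auto dest: injD)
  then have quad: "(L *v z) \<bullet> ?w = z \<bullet> z"
    by (metis dot_lmul_matrix inner_commute transpose_matrix_vector)
  have "sqrt ((2 * pi) ^ CARD('n) * det ?S) = sqrt (2 * pi) ^ CARD('n) * \<bar>det L\<bar>"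
    by (simp add: det_mul real_sqrt_mult real_sqrt_power power_mult_distrib)
  moreover have "exp (- (z \<bullet> z) / 2) = (\<Prod>i\<in>UNIV. exp (- (z $ i)\<^sup>2 / 2))"
    by (simp add: inner_vec_def exp_sum[symmetric] sum_negf sum_divide_distrib power2_eq_square)
  ultimately show ?thesis
    by (simp add: mvn_density_def quad normal_density_def prod_dividef)
qed

lemma sum_UNIV_option: "(\<Sum>p\<in>UNIV. f p) = f None + (\<Sum>i\<in>UNIV. f (Some i))"
  for f :: "'a::finite option \<Rightarrow> 'b::comm_monoid_add"
  by (simp add: UNIV_option_conv sum.reindex)

lemma prod_UNIV_option: "(\<Prod>p\<in>UNIV. f p) = f None * (\<Prod>i\<in>UNIV. f (Some i))"
  for f :: "'a::finite option \<Rightarrow> 'b::comm_monoid_mult"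
  by (simp add: UNIV_option_conv prod.reindex)

text \<open>The determinant results of the library for triangular matrices need a well-ordered index
  type, which \<open>'k option\<close> is not.\<close>

lemma det_arrow:
  fixes A :: "'a::comm_ring_1^('k::finite option)^('k option)"
  assumes None: "\<And>i. A $ None $ Some i = 0"
    and Some: "\<And>i j. i \<noteq> j \<Longrightarrow> A $ Some i $ Some j = 0"
  shows "det A = (\<Prod>p\<in>UNIV. A $ p $ p)"
proof -
  \<comment> \<open>A nonzero product forces \<open>p None = None\<close>, since row
    \<open>None\<close> is zero off the diagonal. Injectivity then keeps each \<open>Some i\<close>
    away from \<open>None\<close>, and only the diagonal entry of its row remains.\<close>
  have "(\<Prod>q\<in>UNIV. A $ q $ p q) = 0" if p: "p permutes UNIV" "p \<noteq> id" for p
  proof (rule ccontr)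
    assume "(\<Prod>q\<in>UNIV. A $ q $ p q) \<noteq> 0"
    then have nz: "A $ q $ p q \<noteq> 0" for q
      by (metis UNIV_I finite prod_zero)
    have pN: "p None = None"
      using nz[of None] None by (cases "p None") auto
    have "p (Some i) = Some i" for i
    proof (cases "p (Some i)")
      case None
      with pN show ?thesis
        using permutes_inj[OF p(1)] by (metis injD option.distinct(1))
    next
      case (Some j)
      with nz[of "Some i"] assms(2)[of i j] show ?thesis by auto
    qed
    with pN have "p = id"
      by (auto simp: fun_eq_iff) (metis option.exhaust)
    with p show False by simp
  qed
  then have "det A = (\<Sum>p\<in>{id}. of_int (sign p) * (\<Prod>q\<in>UNIV. A $ q $ p q))"
    unfolding det_def
    by (intro sum.mono_neutral_right) (auto simp: permutes_id)
  then show ?thesis by (simp add: sign_id)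
qed


section \<open>Factorisation of the conditional density of \<xi>\<close>

lemma normal_density_inverse_scale:
  assumes "r > 0"
  shows "normal_density \<nu> (1 / r) x = r * std_normal_density (r * (x - \<nu>))"
  using assms by (simp add: normal_density_def real_sqrt_mult real_sqrt_divide power_divide field_simps)
    (simp add: power2_eq_square algebra_simps)

lemma t_sum_nonneg:
  assumes "lt > 0" "le > 0"
  shows "t_sum m (lt, le) \<ge> 0"
  using assms by (auto simp: t_sum_def intro!: sum_nonneg divide_nonneg_nonneg add_nonneg_nonneg)

text \<open>The factors are the law of \<mu> and the laws of the \<theta> coordinates given \<mu>,
  all with \<lambda> fixed. They appear once the covariance is written as
  \<open>L ** transpose L\<close> with an arrow-shaped \<open>L\<close>, to which
  \<open>mvn_density_affine\<close> and \<open>det_arrow\<close> apply.\<close>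

lemma xi_density_eq:
  fixes \<xi> :: "real^('k::finite option)" and lt le :: real
  assumes "lt > 0" "le > 0" "s0 > 0"
  shows "xi_density m y s0 m0 (lt, le) \<xi> =
    normal_density (mu_mean m y s0 m0 (lt, le)) (1 / sqrt (s0 + t_sum m (lt, le))) (mu_of \<xi>) *
    (\<Prod>i\<in>UNIV. normal_density ((lt * mu_of \<xi> + m i * le * group_mean m y i) / (lt + m i * le))
                 (1 / sqrt (lt + m i * le)) (theta_of \<xi> $ i))"
proof -
  define s where "s = s0 + t_sum m (lt, le)"
  define d where "d i = lt + m i * le" for i
  have s: "s > 0"
    using t_sum_nonneg[OF assms(1,2), of m] assms(3) by (simp add: s_def)
  have d: "d i > 0" for i
    using assms by (simp add: d_def add_pos_nonneg)
  define \<nu> where "\<nu> = xi_mean m y s0 m0 (lt, le)"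
  have \<nu>N: "\<nu> $ None = mu_mean m y s0 m0 (lt, le)"
    by (simp add: \<nu>_def xi_mean_def)
  have \<nu>S: "\<nu> $ Some i = (lt * \<nu> $ None + m i * le * group_mean m y i) / d i" for i
    by (simp add: \<nu>_def xi_mean_def d_def)
  \<comment> \<open>The columns of \<open>L\<close> record hierarchical sampling: noise of size
    \<open>1 / sqrt s\<close> in \<mu> is passed on to each \<theta> coordinate with slope
    \<open>lt / d i\<close>, and that coordinate adds its own noise of size
    \<open>1 / sqrt (d i)\<close>.\<close>
  define L :: "real^('k option)^('k option)" where "L = (\<chi> p q. case (p, q) of
       (None, None) \<Rightarrow> 1 / sqrt s
     | (Some i, None) \<Rightarrow> lt / (d i * sqrt s)
     | (None, Some j) \<Rightarrow> 0
     | (Some i, Some j) \<Rightarrow> if i = j then 1 / sqrt (d i) else 0)"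
  \<comment> \<open>Solution of \<open>\<xi> = \<nu> + L *v z\<close> by forward substitution,
    starting from coordinate \<open>None\<close>.\<close>
  define z :: "real^('k option)" where "z = (\<chi> p. case p of
       None \<Rightarrow> sqrt s * (\<xi> $ None - \<nu> $ None)
     | Some i \<Rightarrow> sqrt (d i) * (\<xi> $ Some i - \<nu> $ Some i - lt / d i * (\<xi> $ None - \<nu> $ None)))"
  have det: "det L = 1 / sqrt s * (\<Prod>i\<in>UNIV. 1 / sqrt (d i))"
    by (subst det_arrow) (auto simp: L_def prod_UNIV_option)
  have inv: "invertible L"
    using s d by (simp add: invertible_det_nz det less_imp_neq[THEN not_sym])
  have cov: "xi_cov m s0 (lt, le) = L ** transpose L"
  proof -
    have dd: "lt + real (m i) * le = d i" "lt + le * real (m i) = d i" for i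
      by (simp_all add: d_def mult.commute)
    have ss: "sqrt s * (sqrt s * x) = s * x" for x
      using s by (simp flip: mult.assoc)
    have "xi_cov m s0 (lt, le) $ p $ q = (L ** transpose L) $ p $ q" for p q
      using s less_imp_neq[OF d, THEN not_sym] less_imp_le[OF d]
      by (cases p; cases q)
        (auto simp: xi_cov_def L_def matrix_matrix_mult_def transpose_def sum_UNIV_option Let_def
          s_def[symmetric] dd ss if_distrib[where f = "\<lambda>x. _ * x"]
          power2_eq_square mult_ac distrib_left cong: if_cong)
    then show ?thesis by (simp add: vec_eq_iff)
  qed
  have \<xi>: "\<xi> = \<nu> + L *v z"
  proof -
    have "\<xi> $ p = (\<nu> + L *v z) $ p" for p
      using s d less_imp_neq[OF s] less_imp_neq[OF d]
      by (cases p) (auto simp: matrix_vector_mult_def L_def z_def sum_UNIV_option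
          if_distrib[where f = "\<lambda>x. x * _"] cong: if_cong)
    then show ?thesis by (simp add: vec_eq_iff)
  qed
  \<comment> \<open>The mean of a \<theta> coordinate is affine in the mean of \<mu> with slope
    \<open>lt / d i\<close>; the correction replaces that mean by the actual value of \<mu>, which
    gives the conditional mean given \<mu>.\<close>
  have arg: "\<xi> $ Some i - \<nu> $ Some i - lt * (\<xi> $ None - \<nu> $ None) / d i
      = \<xi> $ Some i - (lt * \<xi> $ None + m i * le * group_mean m y i) / d i" for i
    by (simp add: \<nu>S algebra_simps add_divide_distrib diff_divide_distrib)
  have "xi_density m y s0 m0 (lt, le) \<xi> = (\<Prod>p\<in>UNIV. std_normal_density (z $ p)) / \<bar>det L\<bar>"
    unfolding xi_density_def cov \<nu>_def[symmetric] using mvn_density_affine[OF inv, of \<nu> z]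
    by (simp flip: \<xi>)
  also have "\<dots> = sqrt s * std_normal_density (sqrt s * (\<xi> $ None - \<nu> $ None)) *
      (\<Prod>i\<in>UNIV. sqrt (d i) * std_normal_density
         (sqrt (d i) * (\<xi> $ Some i - (lt * \<xi> $ None + m i * le * group_mean m y i) / d i)))"
    using s d by (simp add: det prod_UNIV_option z_def arg prod.distrib prod_dividef abs_mult prod_nonneg less_imp_le)
  also have "\<dots> = normal_density (\<nu> $ None) (1 / sqrt s) (\<xi> $ None) *
      (\<Prod>i\<in>UNIV. normal_density ((lt * \<xi> $ None + m i * le * group_mean m y i) / d i)
         (1 / sqrt (d i)) (\<xi> $ Some i))"
    using s d by (simp add: normal_density_inverse_scale)
  finally show ?thesis
    by (simp add: \<nu>N s_def d_def mu_of_def theta_of_def)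
qed

section \<open>Conditional second moments given the precisions\<close>

text \<open>Given \<mu>, the coordinates of \<theta> other than \<open>k\<close> have independent
  densities that integrate to 1. Functions of one \<theta> coordinate and \<mu> suffice, because
  \<open>v1\<close> and \<open>v2\<close> are sums of such functions.\<close>

lemma nn_integral_xi_density_pair:
  fixes m :: "'k::finite \<Rightarrow> nat" and lt le :: real
  assumes "lt > 0" "le > 0" "s0 > 0"
    and f: "(\<lambda>(x, \<mu>). f x \<mu>) \<in> borel_measurable (borel \<Otimes>\<^sub>M borel)"
  shows "(\<integral>\<^sup>+\<xi>. f (theta_of \<xi> $ k) (mu_of \<xi>) * ennreal (xi_density m y s0 m0 (lt, le) \<xi>) \<partial>lborel) =
    (\<integral>\<^sup>+\<mu>. (\<integral>\<^sup>+x. f x \<mu> * ennreal (normal_density ((lt * \<mu> + m k * le * group_mean m y k) / (lt + m k * le))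
                 (1 / sqrt (lt + m k * le)) x) \<partial>lborel)
       * ennreal (normal_density (mu_mean m y s0 m0 (lt, le)) (1 / sqrt (s0 + t_sum m (lt, le))) \<mu>) \<partial>lborel)"
proof -
  interpret product_sigma_finite "\<lambda>_::'k option. lborel :: real measure" ..
  note f[measurable]
  define N where "N \<mu> = normal_density (mu_mean m y s0 m0 (lt, le)) (1 / sqrt (s0 + t_sum m (lt, le))) \<mu>" for \<mu>
  define h where "h i \<mu> x = normal_density ((lt * \<mu> + m i * le * group_mean m y i) / (lt + m i * le))
                 (1 / sqrt (lt + m i * le)) x" for i \<mu> x
  have [measurable]: "N \<in> borel_measurable borel" "\<And>i. (\<lambda>(\<mu>, x). h i \<mu> x) \<in> borel_measurable (borel \<Otimes>\<^sub>M borel)"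
    unfolding N_def h_def normal_density_def by measurable
  have d: "lt + m i * le > 0" for i
    using assms by (simp add: add_pos_nonneg)
  have h_nonneg: "h i \<mu> x \<ge> 0" and N_nonneg: "N \<mu> \<ge> 0" for i \<mu> x
    by (simp_all add: h_def N_def normal_density_nonneg)
  have h1: "(\<integral>\<^sup>+x. ennreal (h i \<mu> x) \<partial>lborel) = 1" for i \<mu>
    using d by (simp add: h_def nn_integral_normal_density)
  have [measurable]: "(\<lambda>g. \<chi> i. g i) \<in> borel_measurable (\<Pi>\<^sub>M p\<in>(UNIV::'k option set). (lborel :: real measure))"
    by (rule borel_measurable_vec_lambda) simp
  have meas: "(\<lambda>g. f (g (Some k)) (g None) * ennreal (N (g None) * (\<Prod>i\<in>UNIV. h i (g None) (g (Some i)))))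
      \<in> borel_measurable (\<Pi>\<^sub>M p\<in>(UNIV::'k option set). (lborel :: real measure))"
    by measurable
  have inner: "(\<integral>\<^sup>+g. f (g (Some k)) \<mu> * ennreal (\<Prod>i\<in>UNIV. h i \<mu> (g (Some i))) \<partial>(\<Pi>\<^sub>M p\<in>range Some. lborel))
      = (\<integral>\<^sup>+x. f x \<mu> * ennreal (h k \<mu> x) \<partial>lborel)" for \<mu>
  proof -
    \<comment> \<open>For fixed \<mu>, attaching \<open>f\<close> to factor \<open>k\<close> and 1
      to the others makes the integrand a product over coordinates, so the integral is a product of
      one-dimensional integrals.\<close>
    have "f (g (Some k)) \<mu> * ennreal (\<Prod>i\<in>UNIV. h i \<mu> (g (Some i)))
        = (\<Prod>p\<in>range Some. (if the p = k then f (g p) \<mu> else 1) * ennreal (h (the p) \<mu> (g p)))" for g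
      by (simp add: prod.reindex prod.distrib prod_ennreal[symmetric] h_nonneg)
    then have "(\<integral>\<^sup>+g. f (g (Some k)) \<mu> * ennreal (\<Prod>i\<in>UNIV. h i \<mu> (g (Some i))) \<partial>(\<Pi>\<^sub>M p\<in>range Some. lborel))
        = (\<Prod>p\<in>range Some. \<integral>\<^sup>+x. (if the p = k then f x \<mu> else 1) * ennreal (h (the p) \<mu> x) \<partial>lborel)"
      by (simp only:) (intro product_nn_integral_prod; measurable)
    also have "\<dots> = (\<Prod>i\<in>UNIV. \<integral>\<^sup>+x. (if i = k then f x \<mu> else 1) * ennreal (h i \<mu> x) \<partial>lborel)"
      by (simp add: prod.reindex)
    also have "\<dots> = (\<Prod>i\<in>UNIV. if i = k then \<integral>\<^sup>+x. f x \<mu> * ennreal (h k \<mu> x) \<partial>lborel else 1)"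
      by (intro prod.cong) (auto simp: h1)
    finally show ?thesis by simp
  qed
  have "(\<integral>\<^sup>+\<xi>. f (theta_of \<xi> $ k) (mu_of \<xi>) * ennreal (xi_density m y s0 m0 (lt, le) \<xi>) \<partial>lborel)
      = (\<integral>\<^sup>+\<xi>. f (\<xi> $ Some k) (\<xi> $ None) *
           ennreal (N (\<xi> $ None) * (\<Prod>i\<in>UNIV. h i (\<xi> $ None) (\<xi> $ Some i))) \<partial>lborel)"
    using assms by (simp add: xi_density_eq N_def h_def mu_of_def theta_of_def)
  also have "\<dots> = (\<integral>\<^sup>+g. f (g (Some k)) (g None) *
           ennreal (N (g None) * (\<Prod>i\<in>UNIV. h i (g None) (g (Some i)))) \<partial>(\<Pi>\<^sub>M p\<in>UNIV. lborel))"
    by (subst lborel_vec_eq_distr_PiM, subst nn_integral_distr) simp_all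
  \<comment> \<open>Tonelli: coordinate \<open>None\<close>, which holds \<mu>, is split off as the
    outer variable.\<close>
  also have "\<dots> = (\<integral>\<^sup>+\<mu>. \<integral>\<^sup>+g. f (g (Some k)) \<mu> *
           ennreal (N \<mu> * (\<Prod>i\<in>UNIV. h i \<mu> (g (Some i)))) \<partial>(\<Pi>\<^sub>M p\<in>range Some. lborel) \<partial>lborel)"
    using meas unfolding UNIV_option_conv
    by (subst product_nn_integral_insert_rev) simp_all
  also have "\<dots> = (\<integral>\<^sup>+\<mu>. (\<integral>\<^sup>+g. f (g (Some k)) \<mu> * ennreal (\<Prod>i\<in>UNIV. h i \<mu> (g (Some i)))
           \<partial>(\<Pi>\<^sub>M p\<in>range Some. lborel)) * ennreal (N \<mu>) \<partial>lborel)"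
    by (intro nn_integral_cong, subst nn_integral_multc[symmetric])
      (auto simp: ennreal_mult' N_nonneg mult_ac)
  finally show ?thesis
    unfolding inner unfolding N_def h_def .
qed

text \<open>The normal second moment is used twice: over \<theta> given \<mu> it leaves
  \<open>1 / d\<close> plus the square of an affine function of \<mu>, which is then integrated over
  \<mu>. The parameters \<open>r\<close> and \<open>c\<close> serve both \<open>v1\<close>
  (\<open>r = 1\<close>, \<open>c = 0\<close>) and \<open>v2\<close> (\<open>r = 0\<close>,
  \<open>c\<close> the group mean).\<close>

lemma nn_integral_xi_density_square:
  fixes m :: "'k::finite \<Rightarrow> nat" and lt le :: real
  assumes "lt > 0" "le > 0" "s0 > 0"
  shows "(\<integral>\<^sup>+\<xi>. ennreal ((theta_of \<xi> $ k - (r * mu_of \<xi> + c))\<^sup>2) *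
      ennreal (xi_density m y s0 m0 (lt, le) \<xi>) \<partial>lborel) =
    ennreal (1 / (lt + m k * le) + (lt / (lt + m k * le) - r)\<^sup>2 / (s0 + t_sum m (lt, le))
      + ((lt * mu_mean m y s0 m0 (lt, le) + m k * le * group_mean m y k) / (lt + m k * le)
         - (r * mu_mean m y s0 m0 (lt, le) + c))\<^sup>2)"
proof -
  define s where "s = s0 + t_sum m (lt, le)"
  define d where "d = lt + m k * le"
  define \<nu> where "\<nu> = mu_mean m y s0 m0 (lt, le)"
  define q where "q = m k * le * group_mean m y k"
  have s: "s > 0"
    using t_sum_nonneg[OF assms(1,2), of m] assms(3) by (simp add: s_def)
  have d: "d > 0"
    using assms by (simp add: d_def add_pos_nonneg)
  have "(\<integral>\<^sup>+\<xi>. ennreal ((theta_of \<xi> $ k - (r * mu_of \<xi> + c))\<^sup>2) *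
      ennreal (xi_density m y s0 m0 (lt, le) \<xi>) \<partial>lborel)
    = (\<integral>\<^sup>+\<mu>. (\<integral>\<^sup>+x. ennreal ((x - (r * \<mu> + c))\<^sup>2) * ennreal (normal_density ((lt * \<mu> + q) / d) (1 / sqrt d) x) \<partial>lborel)
       * ennreal (normal_density \<nu> (1 / sqrt s) \<mu>) \<partial>lborel)"
    unfolding s_def d_def \<nu>_def q_def by (rule nn_integral_xi_density_pair[OF assms]) measurable
  also have "\<dots> = (\<integral>\<^sup>+\<mu>. ennreal (1 / d + ((lt / d - r) * \<mu> + (q / d - c))\<^sup>2)
       * ennreal (normal_density \<nu> (1 / sqrt s) \<mu>) \<partial>lborel)"
  proof (intro nn_integral_cong arg_cong2[where f = "(*)"] refl)
    fix \<mu> :: real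
    have "(\<integral>\<^sup>+x. ennreal ((x - (r * \<mu> + c))\<^sup>2) * ennreal (normal_density ((lt * \<mu> + q) / d) (1 / sqrt d) x) \<partial>lborel)
        = (\<integral>\<^sup>+x. ennreal ((1 * x + (- (r * \<mu> + c)))\<^sup>2 * normal_density ((lt * \<mu> + q) / d) (1 / sqrt d) x) \<partial>lborel)"
      by (simp only: ennreal_mult'[OF zero_le_power2] mult_1 add_uminus_conv_diff)
    also have "\<dots> = ennreal (1 / d + ((lt / d - r) * \<mu> + (q / d - c))\<^sup>2)"
      using d by (subst nn_integral_normal_density_square)
        (auto simp: power_divide add_divide_distrib algebra_simps)
    finally show "(\<integral>\<^sup>+x. ennreal ((x - (r * \<mu> + c))\<^sup>2) * ennreal (normal_density ((lt * \<mu> + q) / d) (1 / sqrt d) x) \<partial>lborel)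
        = ennreal (1 / d + ((lt / d - r) * \<mu> + (q / d - c))\<^sup>2)" .
  qed
  also have "\<dots> = (\<integral>\<^sup>+\<mu>. ennreal (1 / d) * ennreal (normal_density \<nu> (1 / sqrt s) \<mu>) +
      ennreal (((lt / d - r) * \<mu> + (q / d - c))\<^sup>2 * normal_density \<nu> (1 / sqrt s) \<mu>) \<partial>lborel)"
    using d by (intro nn_integral_cong)
      (simp add: ennreal_mult'[symmetric] ennreal_plus[symmetric] normal_density_nonneg ring_distribs
        del: ennreal_plus)
  also have "\<dots> = ennreal (1 / d) + ennreal ((lt / d - r)\<^sup>2 / s + ((lt / d - r) * \<nu> + (q / d - c))\<^sup>2)"
    using s by (simp add: nn_integral_add nn_integral_cmult nn_integral_normal_density
        nn_integral_normal_density_square power_divide)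
  also have "\<dots> = ennreal (1 / d + (lt / d - r)\<^sup>2 / s + ((lt * \<nu> + q) / d - (r * \<nu> + c))\<^sup>2)"
    using s d by (subst ennreal_plus[symmetric]) (auto simp: algebra_simps add_divide_distrib)
  finally show ?thesis
    by (simp add: s_def d_def \<nu>_def q_def)
qed

section \<open>Measurability, and conditional expectations of \<open>v1\<close> and
  \<open>v2\<close>\<close>

text \<open>Joint measurability is read off from the factorised form, which is available for
  positive precisions only; hence the cutoff. The gamma factors of the kernel vanish where the
  cutoff acts.\<close>

lemma borel_measurable_xi_density_pos:
  fixes m :: "'k::finite \<Rightarrow> nat"
  assumes "s0 > 0"
  shows "(\<lambda>((lt, le), \<xi>). if lt > 0 \<and> le > 0 then xi_density m y s0 m0 (lt, le) \<xi> else 0)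
    \<in> borel_measurable borel"
proof -
  have [measurable]: "(\<lambda>x::(real \<times> real) \<times> (real^('k option)). fst (fst x)) \<in> borel_measurable borel"
    "(\<lambda>x::(real \<times> real) \<times> (real^('k option)). snd (fst x)) \<in> borel_measurable borel"
    "\<And>p. (\<lambda>x::(real \<times> real) \<times> (real^('k option)). snd x $ p) \<in> borel_measurable borel"
    by (intro borel_measurable_continuous_onI continuous_intros)+
  have "(\<lambda>x::(real \<times> real) \<times> (real^('k option)). if fst (fst x) > 0 \<and> snd (fst x) > 0 then
     normal_density (mu_mean m y s0 m0 (fst (fst x), snd (fst x)))
       (1 / sqrt (s0 + t_sum m (fst (fst x), snd (fst x)))) (snd x $ None) *
     (\<Prod>i\<in>UNIV. normal_density ((fst (fst x) * snd x $ None + m i * snd (fst x) * group_mean m y i)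
          / (fst (fst x) + m i * snd (fst x)))
        (1 / sqrt (fst (fst x) + m i * snd (fst x))) (snd x $ Some i)) else 0) \<in> borel_measurable borel"
    unfolding mu_mean_def t_sum_def normal_density_def by simp measurable
  then show ?thesis
    using assms
    by (elim measurable_cong[THEN iffD1, rotated])
      (auto simp: xi_density_eq mu_of_def theta_of_def split_beta)
qed

lemma borel_measurable_xi_density:
  fixes m :: "'k::finite \<Rightarrow> nat"
  assumes "lt > 0" "le > 0" "s0 > 0"
  shows "xi_density m y s0 m0 (lt, le) \<in> borel_measurable borel"
proof -
  have "(\<lambda>\<xi>::real^('k option). ((lt, le), \<xi>)) \<in> borel \<rightarrow>\<^sub>M borel"
    by (intro borel_measurable_continuous_onI continuous_intros)
  from measurable_compose[OF this borel_measurable_xi_density_pos[OF assms(3)], of m y m0]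
  show ?thesis
    using assms by simp
qed

lemma borel_measurable_theta_of [measurable]:
  "(\<lambda>\<xi>::real^('k::finite option). theta_of \<xi> $ i) \<in> borel_measurable borel"
  unfolding theta_of_def by (auto intro!: borel_measurable_continuous_onI continuous_intros)

lemma borel_measurable_mu_of [measurable]:
  "(mu_of :: real^('k::finite option) \<Rightarrow> real) \<in> borel_measurable borel"
  unfolding mu_of_def by (auto intro!: borel_measurable_continuous_onI continuous_intros)

lemma v1_nonneg: "v1 \<theta> \<mu> \<ge> 0"
  by (simp add: v1_def sum_nonneg)

lemma v2_nonneg: "v2 m y \<theta> \<ge> 0"
  by (simp add: v2_def sum_nonneg)

lemma SSE_nonneg: "SSE m y \<ge> 0"
  by (simp add: SSE_def sum_nonneg)

text \<open>In each summand, both the slope in \<mu> and the distance of the means carry the factor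
  \<open>e / (lt + e)\<close> up to sign, where \<open>e = m i * le\<close>. The squares therefore
  share one coefficient.\<close>

lemma nn_integral_v1_xi_density:
  fixes m :: "'k::finite \<Rightarrow> nat" and lt le :: real
  assumes "lt > 0" "le > 0" "s0 > 0"
  shows "(\<integral>\<^sup>+\<xi>. ennreal (v1 (theta_of \<xi>) (mu_of \<xi>)) * ennreal (xi_density m y s0 m0 (lt, le) \<xi>) \<partial>lborel) =
    ennreal (\<Sum>i\<in>UNIV. 1 / (lt + m i * le) + (m i * le / (lt + m i * le))\<^sup>2 *
      (1 / (s0 + t_sum m (lt, le)) + (mu_mean m y s0 m0 (lt, le) - group_mean m y i)\<^sup>2))"
proof -
  note [measurable] = borel_measurable_xi_density[OF assms]
  have s: "s0 + t_sum m (lt, le) > 0"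
    using t_sum_nonneg[OF assms(1,2), of m] assms(3) by simp
  have d: "lt + m i * le > 0" for i
    using assms by (simp add: add_pos_nonneg)
  have summand: "(\<integral>\<^sup>+\<xi>. ennreal ((theta_of \<xi> $ i - mu_of \<xi>)\<^sup>2) *
        ennreal (xi_density m y s0 m0 (lt, le) \<xi>) \<partial>lborel) =
     ennreal (1 / (lt + m i * le) + (m i * le / (lt + m i * le))\<^sup>2 *
      (1 / (s0 + t_sum m (lt, le)) + (mu_mean m y s0 m0 (lt, le) - group_mean m y i)\<^sup>2))" for i
  proof -
    define \<nu> where "\<nu> = mu_mean m y s0 m0 (lt, le)"
    define e where "e = m i * le"
    have e: "lt + e > 0" using d[of i] by (simp add: e_def)
    have "lt / (lt + e) - 1 = - (e / (lt + e))"
      using e by (simp add: field_simps)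
    then have 1: "(lt / (lt + e) - 1)\<^sup>2 = (e / (lt + e))\<^sup>2"
      by (simp only: power2_minus)
    have "(lt * \<nu> + e * group_mean m y i) / (lt + e) - \<nu> = - (e / (lt + e) * (\<nu> - group_mean m y i))"
      using e by (simp add: field_simps)
    then have 2: "((lt * \<nu> + e * group_mean m y i) / (lt + e) - \<nu>)\<^sup>2
        = (e / (lt + e))\<^sup>2 * (\<nu> - group_mean m y i)\<^sup>2"
      by (simp only: power2_minus power_mult_distrib)
    show ?thesis
      using nn_integral_xi_density_square[OF assms, of i 1 0 m y m0]
      by (simp add: \<nu>_def[symmetric] e_def[symmetric] 1 2 distrib_left add.assoc)
  qed
  have "(\<integral>\<^sup>+\<xi>. ennreal (v1 (theta_of \<xi>) (mu_of \<xi>)) * ennreal (xi_density m y s0 m0 (lt, le) \<xi>) \<partial>lborel)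
    = (\<integral>\<^sup>+\<xi>. (\<Sum>i\<in>UNIV. ennreal ((theta_of \<xi> $ i - mu_of \<xi>)\<^sup>2) *
        ennreal (xi_density m y s0 m0 (lt, le) \<xi>)) \<partial>lborel)"
    by (simp add: v1_def sum_ennreal[symmetric] sum_distrib_right del: sum_ennreal)
  also have "\<dots> = (\<Sum>i\<in>UNIV. ennreal (1 / (lt + m i * le) + (m i * le / (lt + m i * le))\<^sup>2 *
      (1 / (s0 + t_sum m (lt, le)) + (mu_mean m y s0 m0 (lt, le) - group_mean m y i)\<^sup>2)))"
    by (subst nn_integral_sum) (simp_all add: summand)
  finally show ?thesis
    using s d by (simp add: sum_ennreal less_imp_le del: ennreal_plus)
qed

text \<open>As for \<open>v1\<close>, but centring at the group mean makes the common factor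
  \<open>lt / (lt + e)\<close>.\<close>

lemma nn_integral_v2_xi_density:
  fixes m :: "'k::finite \<Rightarrow> nat" and lt le :: real
  assumes "lt > 0" "le > 0" "s0 > 0"
  shows "(\<integral>\<^sup>+\<xi>. ennreal (v2 m y (theta_of \<xi>)) * ennreal (xi_density m y s0 m0 (lt, le) \<xi>) \<partial>lborel) =
    ennreal (\<Sum>i\<in>UNIV. m i * (1 / (lt + m i * le) + (lt / (lt + m i * le))\<^sup>2 *
      (1 / (s0 + t_sum m (lt, le)) + (mu_mean m y s0 m0 (lt, le) - group_mean m y i)\<^sup>2)))"
proof -
  note [measurable] = borel_measurable_xi_density[OF assms]
  have s: "s0 + t_sum m (lt, le) > 0"
    using t_sum_nonneg[OF assms(1,2), of m] assms(3) by simp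
  have d: "lt + m i * le > 0" for i
    using assms by (simp add: add_pos_nonneg)
  have summand: "(\<integral>\<^sup>+\<xi>. ennreal ((theta_of \<xi> $ i - group_mean m y i)\<^sup>2) *
        ennreal (xi_density m y s0 m0 (lt, le) \<xi>) \<partial>lborel) =
     ennreal (1 / (lt + m i * le) + (lt / (lt + m i * le))\<^sup>2 *
      (1 / (s0 + t_sum m (lt, le)) + (mu_mean m y s0 m0 (lt, le) - group_mean m y i)\<^sup>2))" for i
  proof -
    define \<nu> where "\<nu> = mu_mean m y s0 m0 (lt, le)"
    define e where "e = m i * le"
    have e: "lt + e > 0" using d[of i] by (simp add: e_def)
    have 2: "(lt * \<nu> + e * group_mean m y i) / (lt + e) - group_mean m y i
        = lt / (lt + e) * (\<nu> - group_mean m y i)"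
      using e by (simp add: field_simps)
    show ?thesis
      using nn_integral_xi_density_square[OF assms, of i 0 "group_mean m y i" m y m0]
      by (simp add: \<nu>_def[symmetric] e_def[symmetric] 2 power_mult_distrib distrib_left add.assoc
          del: times_divide_eq_left)
  qed
  have "(\<integral>\<^sup>+\<xi>. ennreal (v2 m y (theta_of \<xi>)) * ennreal (xi_density m y s0 m0 (lt, le) \<xi>) \<partial>lborel)
    = (\<integral>\<^sup>+\<xi>. (\<Sum>i\<in>UNIV. ennreal (m i) * (ennreal ((theta_of \<xi> $ i - group_mean m y i)\<^sup>2) *
        ennreal (xi_density m y s0 m0 (lt, le) \<xi>))) \<partial>lborel)"
    by (simp add: v2_def sum_ennreal[symmetric] sum_distrib_right ennreal_mult' mult.assoc del: sum_ennreal)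
  also have "\<dots> = (\<Sum>i\<in>UNIV. ennreal (m i * (1 / (lt + m i * le) + (lt / (lt + m i * le))\<^sup>2 *
      (1 / (s0 + t_sum m (lt, le)) + (mu_mean m y s0 m0 (lt, le) - group_mean m y i)\<^sup>2))))"
    by (subst nn_integral_sum) (simp_all add: nn_integral_cmult summand ennreal_mult')
  finally show ?thesis
    using s d by (simp add: sum_ennreal less_imp_le del: ennreal_plus)
qed

section \<open>Bounding the conditional expectation of \<open>V2\<close> in the balanced
  case\<close>

lemma square_weighted_mean_le_max:
  fixes w1 w2 a b :: real
  assumes "w1 \<ge> 0" "w2 \<ge> 0" "w1 + w2 > 0"
  shows "((w1 * a + w2 * b) / (w1 + w2))\<^sup>2 \<le> max (a\<^sup>2) (b\<^sup>2)"
proof -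
  have "\<bar>w1 * a + w2 * b\<bar> \<le> w1 * \<bar>a\<bar> + w2 * \<bar>b\<bar>"
    using assms by (intro order_trans[OF abs_triangle_ineq]) (simp add: abs_mult)
  also have "\<dots> \<le> w1 * max \<bar>a\<bar> \<bar>b\<bar> + w2 * max \<bar>a\<bar> \<bar>b\<bar>"
    using assms by (intro add_mono mult_left_mono) auto
  finally have "\<bar>(w1 * a + w2 * b) / (w1 + w2)\<bar> \<le> max \<bar>a\<bar> \<bar>b\<bar>"
    using assms by (simp add: abs_divide divide_le_eq algebra_simps)
  then have "\<bar>(w1 * a + w2 * b) / (w1 + w2)\<bar>\<^sup>2 \<le> (max \<bar>a\<bar> \<bar>b\<bar>)\<^sup>2"
    by (intro power_mono) auto
  also have "\<dots> \<le> max (a\<^sup>2) (b\<^sup>2)"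
    by (auto simp: max_def)
  finally show ?thesis by (simp only: power2_abs)
qed

text \<open>Here \<open>u\<close> is \<open>lt\<close>, \<open>e\<close> is \<open>m * le\<close>,
  and \<open>q i\<close> is the squared distance of the mean of \<mu> from a group mean. The terms
  in \<open>1 / (u + e)\<close>, in \<open>1 / s\<close> and in \<open>q\<close> are bounded
  separately.\<close>

lemma drift_inequality:
  fixes q B :: "'k::finite \<Rightarrow> real" and \<phi> u e s :: real
  assumes "u > 0" "e > 0" "\<phi> > 0" and s: "s \<ge> CARD('k) * u * e / (u + e)"
    and qB: "\<And>i. 0 \<le> q i" "\<And>i. q i \<le> B i"
  shows "\<phi> * (\<Sum>i\<in>UNIV. 1 / (u + e) + (e / (u + e))\<^sup>2 * (1 / s + q i))
      + (\<Sum>i\<in>UNIV. 1 / (u + e) + (u / (u + e))\<^sup>2 * (1 / s + q i))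
    \<le> \<phi> / u + (\<phi> * CARD('k) + CARD('k) + 1) / e + max \<phi> 1 * (\<Sum>i\<in>UNIV. B i)"
proof -
  let ?n = "real CARD('k)" and ?d = "u + e" and ?q = "\<Sum>i\<in>UNIV. q i"
  have n: "?n > 0" by simp
  have d: "?d > 0" using assms by simp
  have s0: "?n * u * e / ?d > 0" using assms d n by simp
  \<comment> \<open>The lower bound on \<open>s\<close> grows with the number of groups, so summing
    \<open>1 / s\<close> over all groups still gives at most
    \<open>(u + e) / (u * e)\<close>.\<close>
  have ns: "?n / s \<le> ?d / (u * e)"
  proof -
    have "?n / s \<le> ?n / (?n * u * e / ?d)"
      using s s0 n by (intro divide_left_mono mult_pos_pos; linarith)
    then show ?thesis using n by simp
  qed
  have le: "1 / ?d \<le> 1 / e" "1 / ?d \<le> 1 / u"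
    using assms by (auto simp: frac_le)
  have "(e / ?d)\<^sup>2 * (?n / s) \<le> (e / ?d)\<^sup>2 * (?d / (u * e))"
    using ns by (intro mult_left_mono) auto
  also have "\<dots> = e / ?d * (1 / u)"
    using assms d by (simp add: power2_eq_square)
  also have "\<dots> \<le> 1 * (1 / u)"
    using assms by (intro mult_right_mono) auto
  finally have 1: "(e / ?d)\<^sup>2 * (?n / s) \<le> 1 / u" by simp
  have "(u / ?d)\<^sup>2 * (?n / s) \<le> (u / ?d)\<^sup>2 * (?d / (u * e))"
    using ns by (intro mult_left_mono) auto
  also have "\<dots> = u / ?d * (1 / e)"
    using assms d by (simp add: power2_eq_square)
  also have "\<dots> \<le> 1 * (1 / e)"
    using assms by (intro mult_right_mono) auto
  finally have 2: "(u / ?d)\<^sup>2 * (?n / s) \<le> 1 / e" by simp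
  \<comment> \<open>The squares of the weights \<open>e / ?d\<close> and \<open>u / ?d\<close> sum
    to at most 1, so the coefficient of \<open>?q\<close> is at most \<open>max \<phi> 1\<close>
    rather than \<open>\<phi> + 1\<close>.\<close>
  have "\<phi> * (e / ?d)\<^sup>2 + (u / ?d)\<^sup>2 \<le> max \<phi> 1 * (e / ?d)\<^sup>2 + max \<phi> 1 * (u / ?d)\<^sup>2"
    by (intro add_mono mult_right_mono) (auto simp: mult_le_cancel_right1)
  also have "\<dots> = max \<phi> 1 * ((e\<^sup>2 + u\<^sup>2) / ?d\<^sup>2)"
    by (simp add: power_divide add_divide_distrib distrib_left)
  also have "\<dots> \<le> max \<phi> 1 * 1"
  proof (intro mult_left_mono)
    have "e\<^sup>2 + u\<^sup>2 \<le> ?d\<^sup>2"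
      using assms by (simp add: power2_sum)
    then show "(e\<^sup>2 + u\<^sup>2) / ?d\<^sup>2 \<le> 1"
      using d by simp
  qed simp
  finally have 3: "\<phi> * (e / ?d)\<^sup>2 + (u / ?d)\<^sup>2 \<le> max \<phi> 1" by simp
  have split: "(\<Sum>i\<in>UNIV. 1 / ?d + x * (1 / s + q i)) = ?n * (1 / ?d) + x * (?n / s + ?q)" for x
    by (simp add: sum.distrib sum_distrib_left[symmetric])
  have "\<phi> * (\<Sum>i\<in>UNIV. 1 / ?d + (e / ?d)\<^sup>2 * (1 / s + q i))
      + (\<Sum>i\<in>UNIV. 1 / ?d + (u / ?d)\<^sup>2 * (1 / s + q i))
    = \<phi> * ?n * (1 / ?d) + ?n * (1 / ?d) + \<phi> * ((e / ?d)\<^sup>2 * (?n / s)) + (u / ?d)\<^sup>2 * (?n / s)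
      + (\<phi> * (e / ?d)\<^sup>2 + (u / ?d)\<^sup>2) * ?q"
    unfolding split by (simp add: algebra_simps)
  \<comment> \<open>Both terms in \<open>1 / ?d\<close> are charged to \<open>1 / e\<close>, giving
    \<open>\<phi> * ?n + ?n\<close>; fact \<open>2\<close> contributes the extra 1, and fact
    \<open>1\<close> the term \<open>\<phi> / u\<close>.\<close>
  also have "\<dots> \<le> \<phi> * ?n * (1 / e) + ?n * (1 / e) + \<phi> * (1 / u) + 1 / e + max \<phi> 1 * (\<Sum>i\<in>UNIV. B i)"
    using assms 1 2 3 le
    by (intro add_mono mult_left_mono mult_mono sum_mono sum_nonneg) (auto simp: mult_nonneg_nonneg)
  also have "\<dots> = \<phi> / u + (\<phi> * ?n + ?n + 1) / e + max \<phi> 1 * (\<Sum>i\<in>UNIV. B i)"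
    by (simp add: add_divide_distrib)
  finally show ?thesis .
qed

text \<open>Equal group sizes give all group means the same weight, so the data enter only through
  their plain average, with total weight \<open>t_sum\<close>, against the prior mean with weight
  \<open>s0\<close>.\<close>

lemma mu_mean_balanced:
  fixes ms :: "'k::finite \<Rightarrow> nat"
  assumes "\<forall>i. ms i = m" "lt > 0" "le > 0"
  shows "mu_mean ms y s0 m0 (lt, le) =
    (t_sum ms (lt, le) * ((\<Sum>i\<in>UNIV. group_mean ms y i) / CARD('k)) + s0 * m0) / (s0 + t_sum ms (lt, le))"
proof -
  have "(\<Sum>i\<in>UNIV. ms i * lt * le * group_mean ms y i / (lt + ms i * le))
      = t_sum ms (lt, le) * ((\<Sum>i\<in>UNIV. group_mean ms y i) / CARD('k))"
    using assms(1) by (simp add: t_sum_def sum_distrib_left sum_divide_distrib mult.assoc)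
  then show ?thesis
    by (simp add: mu_mean_def mult.commute)
qed

lemma nn_integral_V2_xi_density_le:
  fixes ms :: "'k::finite \<Rightarrow> nat" and y :: "'k \<Rightarrow> nat \<Rightarrow> real" and lt le s0 m0 \<phi> :: real
  assumes bal: "\<forall>i. ms i = m" and "m > 0" "\<phi> > 0" and pos: "lt > 0" "le > 0" "s0 > 0"
  defines "ybar \<equiv> (\<Sum>i\<in>UNIV. group_mean ms y i) / CARD('k)"
  shows "(\<integral>\<^sup>+\<xi>. ennreal (\<phi> * v1 (theta_of \<xi>) (mu_of \<xi>) + 1 / m * v2 ms y (theta_of \<xi>)) *
      ennreal (xi_density ms y s0 m0 (lt, le) \<xi>) \<partial>lborel)
    \<le> ennreal (\<phi> * (1 / lt) + (\<phi> * CARD('k) + CARD('k) + 1) / m * (1 / le)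
        + max \<phi> 1 * (\<Sum>i\<in>UNIV. max ((ybar - group_mean ms y i)\<^sup>2) ((m0 - group_mean ms y i)\<^sup>2)))"
proof -
  define t where "t = t_sum ms (lt, le)"
  define \<nu> where "\<nu> = mu_mean ms y s0 m0 (lt, le)"
  define e where "e = m * le"
  define q where "q i = (\<nu> - group_mean ms y i)\<^sup>2" for i
  define B where "B i = max ((ybar - group_mean ms y i)\<^sup>2) ((m0 - group_mean ms y i)\<^sup>2)" for i
  note [measurable] = borel_measurable_xi_density[OF pos]
  have [measurable]: "(\<lambda>\<xi>::real^('k option). v1 (theta_of \<xi>) (mu_of \<xi>)) \<in> borel_measurable borel"
    "(\<lambda>\<xi>::real^('k option). v2 ms y (theta_of \<xi>)) \<in> borel_measurable borel"
    unfolding v1_def v2_def by measurable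
  have e: "e > 0" using assms by (simp add: e_def)
  have t0: "t \<ge> 0" using t_sum_nonneg[OF pos(1,2)] by (simp add: t_def)
  \<comment> \<open>In the balanced case the summands of \<open>t_sum\<close> coincide, so
    \<open>s0 + t\<close> satisfies the lower bound required by
    \<open>drift_inequality\<close>.\<close>
  have t: "CARD('k) * lt * e / (lt + e) = t"
    using bal by (simp add: t_def t_sum_def e_def mult_ac)
  \<comment> \<open>Subtracting a group mean from a weighted mean of \<open>ybar\<close> and
    \<open>m0\<close> leaves a weighted mean of the two differences, whose square is at most the
    larger of their squares.\<close>
  have qB: "q i \<le> B i" for i
  proof -
    have "\<nu> - group_mean ms y i
        = (t * (ybar - group_mean ms y i) + s0 * (m0 - group_mean ms y i)) / (t + s0)"
      using t0 pos mu_mean_balanced[OF bal pos(1,2), of y s0 m0]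
      by (simp add: \<nu>_def t_def[symmetric] ybar_def[symmetric] field_simps)
    then show ?thesis
      using square_weighted_mean_le_max[of t s0] t0 pos by (simp add: q_def B_def)
  qed
  have "(\<integral>\<^sup>+\<xi>. ennreal (\<phi> * v1 (theta_of \<xi>) (mu_of \<xi>) + 1 / m * v2 ms y (theta_of \<xi>)) *
      ennreal (xi_density ms y s0 m0 (lt, le) \<xi>) \<partial>lborel)
    = (\<integral>\<^sup>+\<xi>. ennreal \<phi> * (ennreal (v1 (theta_of \<xi>) (mu_of \<xi>)) * ennreal (xi_density ms y s0 m0 (lt, le) \<xi>))
       + ennreal (1 / m) * (ennreal (v2 ms y (theta_of \<xi>)) * ennreal (xi_density ms y s0 m0 (lt, le) \<xi>)) \<partial>lborel)"
    using assms by (intro nn_integral_cong)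
      (simp add: ennreal_plus ennreal_mult' v1_nonneg v2_nonneg distrib_right mult.assoc
        del: times_divide_eq_left)
  also have "\<dots> = ennreal \<phi> * ennreal (\<Sum>i\<in>UNIV. 1 / (lt + e) + (e / (lt + e))\<^sup>2 * (1 / (s0 + t) + q i))
      + ennreal (1 / m) * ennreal (\<Sum>i\<in>UNIV. m * (1 / (lt + e) + (lt / (lt + e))\<^sup>2 * (1 / (s0 + t) + q i)))"
    using bal by (simp add: nn_integral_add nn_integral_cmult nn_integral_v1_xi_density[OF pos]
        nn_integral_v2_xi_density[OF pos] t_def \<nu>_def e_def q_def)
  also have "\<dots> = ennreal (\<phi> * (\<Sum>i\<in>UNIV. 1 / (lt + e) + (e / (lt + e))\<^sup>2 * (1 / (s0 + t) + q i))
      + (\<Sum>i\<in>UNIV. 1 / (lt + e) + (lt / (lt + e))\<^sup>2 * (1 / (s0 + t) + q i)))"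
    using assms e t0 by (subst ennreal_plus)
      (auto simp: ennreal_mult'[symmetric] sum_distrib_left[symmetric] q_def intro!: mult_nonneg_nonneg sum_nonneg add_nonneg_nonneg)
  also have "\<dots> \<le> ennreal (\<phi> / lt + (\<phi> * CARD('k) + CARD('k) + 1) / e + max \<phi> 1 * (\<Sum>i\<in>UNIV. B i))"
    using assms e t pos qB by (intro ennreal_leI drift_inequality) (auto simp: q_def)
  finally show ?thesis
    by (simp add: B_def e_def)
qed

section \<open>Integration over the precisions and the transition kernel\<close>

lemma nn_integral_gamma_densities:
  assumes "\<alpha>1 > 1" "\<beta>1 > 0" "\<alpha>2 > 1" "\<beta>2 > 0" "A \<ge> 0" "B \<ge> 0" "D \<ge> 0"
  shows "(\<integral>\<^sup>+u. \<integral>\<^sup>+w. ennreal (gamma_density \<alpha>1 \<beta>1 u * gamma_density \<alpha>2 \<beta>2 w) *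
      ennreal (A * (1 / u) + B * (1 / w) + D) \<partial>lborel \<partial>lborel)
    = ennreal (A * (\<beta>1 / (\<alpha>1 - 1)) + B * (\<beta>2 / (\<alpha>2 - 1)) + D)"
proof -
  define g where "g = gamma_density \<alpha>1 \<beta>1"
  define h where "h = gamma_density \<alpha>2 \<beta>2"
  have [measurable]: "g \<in> borel_measurable borel" "h \<in> borel_measurable borel"
    by (simp_all add: g_def h_def)
  have g: "g u \<ge> 0" "u \<le> 0 \<Longrightarrow> g u = 0" and h: "h u \<ge> 0" "u \<le> 0 \<Longrightarrow> h u = 0" for u
    using assms by (simp_all add: g_def h_def gamma_density_nonneg) (simp_all add: gamma_density_def)
  \<comment> \<open>\<open>1 / u\<close> is negative for \<open>u < 0\<close>, but
    \<open>g u / u\<close> is not, because the density vanishes there. This lets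
    \<open>ennreal\<close> distribute over the three terms.\<close>
  have g': "g u / u \<ge> 0" and h': "h u / u \<ge> 0" for u
    using g[of u] h[of u] by (cases "u > 0"; simp)+
  have int: "(\<integral>\<^sup>+u. ennreal (g u) \<partial>lborel) = 1" "(\<integral>\<^sup>+u. ennreal (h u) \<partial>lborel) = 1"
    "(\<integral>\<^sup>+u. ennreal (g u / u) \<partial>lborel) = ennreal (\<beta>1 / (\<alpha>1 - 1))"
    "(\<integral>\<^sup>+u. ennreal (h u / u) \<partial>lborel) = ennreal (\<beta>2 / (\<alpha>2 - 1))"
    unfolding g_def h_def using assms
    by (intro nn_integral_gamma_density nn_integral_gamma_density_inverse; simp)+
  have "ennreal (g u * h w) * ennreal (A * (1 / u) + B * (1 / w) + D) =
      ennreal A * ennreal (g u / u) * ennreal (h w) + ennreal B * ennreal (g u) * ennreal (h w / w)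
      + ennreal D * ennreal (g u) * ennreal (h w)" for u w
  proof -
    have "g u * h w * (A * (1 / u) + B * (1 / w) + D) = A * (g u / u) * h w + B * g u * (h w / w) + D * g u * h w"
      by (simp add: algebra_simps)
    then show ?thesis
      using assms g(1) h(1) g' h'
      by (simp add: ennreal_mult''[symmetric] ennreal_mult'[symmetric] ennreal_plus[symmetric]
          del: ennreal_plus times_divide_eq_left times_divide_eq_right)
  qed
  then have "(\<integral>\<^sup>+u. \<integral>\<^sup>+w. ennreal (g u * h w) * ennreal (A * (1 / u) + B * (1 / w) + D) \<partial>lborel \<partial>lborel)
    = ennreal A * ennreal (\<beta>1 / (\<alpha>1 - 1)) + ennreal B * ennreal (\<beta>2 / (\<alpha>2 - 1)) + ennreal D"
    by (simp add: nn_integral_add nn_integral_cmult nn_integral_multc int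
        del: times_divide_eq_left times_divide_eq_right)
  also have "\<dots> = ennreal (A * (\<beta>1 / (\<alpha>1 - 1)) + B * (\<beta>2 / (\<alpha>2 - 1)) + D)"
    using assms by (simp add: ennreal_mult'[symmetric] ennreal_plus[symmetric] del: ennreal_plus)
  finally show ?thesis by (simp add: g_def h_def)
qed

text \<open>The kernel density is unchanged when its \<xi> factor is cut off to positive precisions,
  since a gamma factor is 0 elsewhere.\<close>

lemma borel_measurable_block_gibbs_density:
  fixes m :: "'k::finite \<Rightarrow> nat"
  assumes "s0 > 0"
  shows "block_gibbs_density m y a1 b1 a2 b2 s0 m0 s \<in> borel_measurable borel"
proof -
  have proj: "(\<lambda>x::(real \<times> real) \<times> (real^('k option)). fst (fst x)) \<in> borel_measurable borel"
    "(\<lambda>x::(real \<times> real) \<times> (real^('k option)). snd (fst x)) \<in> borel_measurable borel"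
    by (intro borel_measurable_continuous_onI continuous_intros)+
  have "(\<lambda>x. lambda_theta_density a1 b1 (snd s) (fst (fst x)) * lambda_e_density m y a2 b2 (snd s) (snd (fst x)) *
      (\<lambda>((lt, le), \<xi>). if lt > 0 \<and> le > 0 then xi_density m y s0 m0 (lt, le) \<xi> else 0) x)
     \<in> borel_measurable borel"
    unfolding lambda_theta_density_def lambda_e_density_def
    by (intro borel_measurable_times borel_measurable_xi_density_pos[OF assms]
        measurable_compose[OF _ borel_measurable_gamma_density] proj)
  then show ?thesis
    by (elim measurable_cong[THEN iffD1, rotated])
      (auto simp: block_gibbs_density_def lambda_theta_density_def lambda_e_density_def gamma_density_def
        split: prod.split)
qed

text \<open>For functions of \<xi> alone, the expectation after one step is computed by conditioning
  on the new precisions: the innermost integral is the conditional expectation given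
  \<lambda>.\<close>

lemma nn_integral_block_gibbs_step:
  fixes m :: "'k::finite \<Rightarrow> nat" and V :: "real^('k option) \<Rightarrow> ennreal"
  assumes pos: "a1 > 0" "b1 > 0" "a2 > 0" "b2 > 0" "s0 > 0" and [measurable]: "V \<in> borel_measurable borel"
  shows "(\<integral>\<^sup>+s'. V (snd s') \<partial>block_gibbs_step m y a1 b1 a2 b2 s0 m0 (lam', \<xi>'))
    = (\<integral>\<^sup>+lt. \<integral>\<^sup>+le. ennreal (lambda_theta_density a1 b1 \<xi>' lt * lambda_e_density m y a2 b2 \<xi>' le) *
        (\<integral>\<^sup>+\<xi>. V \<xi> * ennreal (xi_density m y s0 m0 (lt, le) \<xi>) \<partial>lborel) \<partial>lborel \<partial>lborel)"
proof -
  note [measurable] = borel_measurable_block_gibbs_density[OF pos(5)]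
  let ?F = "\<lambda>s'. ennreal (block_gibbs_density m y a1 b1 a2 b2 s0 m0 (lam', \<xi>') s') * V (snd s')"
  have snd_meas [measurable]: "(snd :: (real \<times> real) \<times> (real^('k option)) \<Rightarrow> _) \<in> borel \<rightarrow>\<^sub>M borel"
    by (intro borel_measurable_continuous_onI continuous_intros)
  have F [measurable]: "?F \<in> borel_measurable borel"
    by measurable
  have inner: "(\<integral>\<^sup>+\<xi>. ?F ((lt, le), \<xi>) \<partial>lborel) =
      ennreal (lambda_theta_density a1 b1 \<xi>' lt * lambda_e_density m y a2 b2 \<xi>' le) *
        (\<integral>\<^sup>+\<xi>. V \<xi> * ennreal (xi_density m y s0 m0 (lt, le) \<xi>) \<partial>lborel)" for lt le
  proof (cases "lt > 0 \<and> le > 0")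
    case True
    then have [measurable]: "xi_density m y s0 m0 (lt, le) \<in> borel_measurable borel"
      using pos by (intro borel_measurable_xi_density) auto
    define c where "c = lambda_theta_density a1 b1 \<xi>' lt * lambda_e_density m y a2 b2 \<xi>' le"
    have "c \<ge> 0"
      using pos by (simp add: c_def lambda_theta_density_def lambda_e_density_def gamma_density_nonneg add_nonneg_pos)
    moreover have "block_gibbs_density m y a1 b1 a2 b2 s0 m0 (lam', \<xi>') ((lt, le), \<xi>)
        = c * xi_density m y s0 m0 (lt, le) \<xi>" for \<xi>
      by (simp add: block_gibbs_density_def c_def)
    ultimately show ?thesis
      unfolding c_def[symmetric]
      by (subst nn_integral_cmult[symmetric])
        (auto simp: ennreal_mult' mult_ac)
  next
    case False
    then have "lambda_theta_density a1 b1 \<xi>' lt * lambda_e_density m y a2 b2 \<xi>' le = 0"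
      by (auto simp: lambda_theta_density_def lambda_e_density_def gamma_density_def)
    then show ?thesis
      by (auto simp: block_gibbs_density_def)
  qed
  have "(\<integral>\<^sup>+s'. V (snd s') \<partial>block_gibbs_step m y a1 b1 a2 b2 s0 m0 (lam', \<xi>')) = (\<integral>\<^sup>+s'. ?F s' \<partial>lborel)"
    unfolding block_gibbs_step_def by (subst nn_integral_density) simp_all
  \<comment> \<open>Tonelli is applied twice: first to separate \<lambda> from \<xi>, then to
    separate the two precisions.\<close>
  also have "\<dots> = (\<integral>\<^sup>+lam. \<integral>\<^sup>+\<xi>. ?F (lam, \<xi>) \<partial>lborel \<partial>lborel)"
  proof -
    have "?F \<in> borel_measurable (lborel \<Otimes>\<^sub>M lborel)"
      using F by (simp add: lborel_prod)
    from lborel.nn_integral_fst[OF this] show ?thesis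
      by (simp add: lborel_prod)
  qed
  also have "\<dots> = (\<integral>\<^sup>+lt. \<integral>\<^sup>+le. \<integral>\<^sup>+\<xi>. ?F ((lt, le), \<xi>) \<partial>lborel \<partial>lborel \<partial>lborel)"
  proof -
    have "(\<lambda>lam. \<integral>\<^sup>+\<xi>. ?F (lam, \<xi>) \<partial>lborel) \<in> borel_measurable (lborel \<Otimes>\<^sub>M lborel)"
      using F by (intro lborel.borel_measurable_nn_integral) (simp add: split_def borel_prod lborel_prod)
    from lborel.nn_integral_fst[OF this] show ?thesis
      by (simp add: lborel_prod)
  qed
  finally show ?thesis
    by (simp only: inner)
qed

section \<open>The drift condition for the block Gibbs sampler\<close>

theorem proposition4p2:
  fixes ms :: "'k::finite \<Rightarrow> nat" and m K M :: nat
    and y :: "'k \<Rightarrow> nat \<Rightarrow> real"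
    and a1 b1 a2 b2 s0 m0 :: real
    and \<delta>1 \<delta>2 \<delta>3 \<delta>5 \<delta> c1 c2 \<gamma> \<phi> ybar b :: real
    and V2 :: "real^'k \<Rightarrow> real \<Rightarrow> real"
    and lt' le' :: real and \<xi>' :: "real^('k option)"
  assumes "a1 > 0" "b1 > 0" "a2 > 0" "b2 > 0" "s0 > 0"
    and "K = CARD('k)" "K \<ge> 3"
    and "\<forall>i. ms i = m" "m \<ge> 2"
    and "M = total_obs ms"
    and "\<delta>1 = 1 / (2 * a1 + real K - 2)"
    and "\<delta>2 = 1 / (2 * a2 + real M - 2)"
    and "\<delta>3 = (real K + 1) * \<delta>2"
    and "\<delta>5 = real K * \<delta>2"
    and "\<delta> = max \<delta>1 \<delta>3"
    and "c1 = 2 * b1 / (2 * a1 + real K - 2)"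
    and "c2 = (2 * b2 + SSE ms y) / (2 * a2 + real M - 2)"
    and "\<delta> < \<gamma>" "\<gamma> < 1"
    and "\<phi> > 0" "\<phi> * \<delta>5 + \<delta> < \<gamma>"
    and "\<And>\<theta> \<mu>. V2 \<theta> \<mu> = \<phi> * v1 \<theta> \<mu> + 1 / real m * v2 ms y \<theta>"
    and "ybar = (\<Sum>i\<in>UNIV. group_mean ms y i) / real K"
    and "b = \<phi> * c1 + (\<phi> * real K + real K + 1) / real m * c2
           + max \<phi> 1 * (\<Sum>i\<in>UNIV. max ((ybar - group_mean ms y i)\<^sup>2) ((m0 - group_mean ms y i)\<^sup>2))"
    and "lt' > 0" "le' > 0"
  shows "integrable (block_gibbs_step ms y a1 b1 a2 b2 s0 m0 ((lt', le'), \<xi>'))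
           (\<lambda>(lam, \<xi>). V2 (theta_of \<xi>) (mu_of \<xi>)) \<and>
         (\<integral>(lam, \<xi>). V2 (theta_of \<xi>) (mu_of \<xi>)
            \<partial>block_gibbs_step ms y a1 b1 a2 b2 s0 m0 ((lt', le'), \<xi>'))
           \<le> \<gamma> * V2 (theta_of \<xi>') (mu_of \<xi>') + b"
proof -
  let ?v1 = "v1 (theta_of \<xi>') (mu_of \<xi>')" and ?v2 = "v2 ms y (theta_of \<xi>')"
  let ?S = "\<Sum>i\<in>UNIV. max ((ybar - group_mean ms y i)\<^sup>2) ((m0 - group_mean ms y i)\<^sup>2)"
  let ?C = "(\<phi> * real K + real K + 1) / real m"
  let ?D = "max \<phi> 1 * ?S"
  let ?M = "block_gibbs_step ms y a1 b1 a2 b2 s0 m0 ((lt', le'), \<xi>')"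
  define V where "V \<xi> = V2 (theta_of \<xi>) (mu_of \<xi>)" for \<xi>
  \<comment> \<open>Expectation, under the two gamma laws of the new precisions, of the bound
    \<open>\<phi> / lt + ?C / le + ?D\<close> on the conditional expectation of
    \<open>V\<close>.\<close>
  define E where "E = \<phi> * ((?v1 / 2 + b1) / (K / 2 + a1 - 1)) + ?C * (((?v2 + SSE ms y) / 2 + b2) / (M / 2 + a2 - 1)) + ?D"
  note V2 = assms(22)
  have V_eq: "V \<xi> = \<phi> * v1 (theta_of \<xi>) (mu_of \<xi>) + 1 / m * v2 ms y (theta_of \<xi>)" for \<xi>
    by (simp add: V_def V2)
  have V_nonneg: "V \<xi> \<ge> 0" for \<xi>
    using assms by (simp add: V_eq v1_nonneg v2_nonneg)
  have [measurable]: "V \<in> borel_measurable borel"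
    unfolding V_eq v1_def v2_def by measurable
  have "M = K * m"
    using assms by (simp add: total_obs_def)
  moreover have "K * m \<ge> 3 * 2"
    using assms by (intro mult_mono) auto
  \<comment> \<open>Together with \<open>K \<ge> 3\<close>, this puts both gamma shapes above 1, as
    the means of the reciprocals require.\<close>
  ultimately have M: "M \<ge> 6" by simp
  have C: "?C \<ge> 0" and S: "?S \<ge> 0" and D: "?D \<ge> 0"
    using assms by (auto intro!: sum_nonneg mult_nonneg_nonneg simp: le_max_iff_disj)
  have K: "K = CARD('k)" and Mt: "total_obs ms = M" using assms by simp_all
  have rates: "?v1 / 2 + b1 > 0" "(?v2 + SSE ms y) / 2 + b2 > 0"
    using assms(2,4) by (simp_all add: add_nonneg_pos v1_nonneg v2_nonneg SSE_nonneg)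
  \<comment> \<open>Doubling numerator and denominator brings the reciprocal means into the form in
    which \<delta>1, \<delta>2, \<open>c1\<close> and \<open>c2\<close> are given.\<close>
  have mean: "(v / 2 + w) / (n / 2 + a - 1) = (v + 2 * w) / (2 * a + n - 2)" for v w n a :: real
  proof -
    have "2 * (v / 2 + w) = v + 2 * w" "2 * (n / 2 + a - 1) = 2 * a + n - 2"
      by (simp_all add: field_simps)
    then show ?thesis
      by (metis mult_divide_mult_cancel_left zero_neq_numeral)
  qed
  have \<delta>1: "(?v1 / 2 + b1) / (K / 2 + a1 - 1) = \<delta>1 * ?v1 + c1"
    unfolding mean assms(11,16) by (simp add: add_divide_distrib)
  have \<delta>2: "((?v2 + SSE ms y) / 2 + b2) / (M / 2 + a2 - 1) = \<delta>2 * ?v2 + c2"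
    unfolding mean assms(12,17) by (simp add: add_divide_distrib)
  have "(\<integral>\<^sup>+s'. ennreal (V (snd s')) \<partial>?M)
      = (\<integral>\<^sup>+lt. \<integral>\<^sup>+le. ennreal (lambda_theta_density a1 b1 \<xi>' lt * lambda_e_density ms y a2 b2 \<xi>' le) *
          (\<integral>\<^sup>+\<xi>. ennreal (V \<xi>) * ennreal (xi_density ms y s0 m0 (lt, le) \<xi>) \<partial>lborel) \<partial>lborel \<partial>lborel)"
    using assms by (intro nn_integral_block_gibbs_step) auto
  also have "\<dots> \<le> (\<integral>\<^sup>+lt. \<integral>\<^sup>+le. ennreal (lambda_theta_density a1 b1 \<xi>' lt * lambda_e_density ms y a2 b2 \<xi>' le) *
          ennreal (\<phi> * (1 / lt) + ?C * (1 / le) + ?D) \<partial>lborel \<partial>lborel)"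
  proof (intro nn_integral_mono)
    fix lt le :: real
    show "ennreal (lambda_theta_density a1 b1 \<xi>' lt * lambda_e_density ms y a2 b2 \<xi>' le) *
          (\<integral>\<^sup>+\<xi>. ennreal (V \<xi>) * ennreal (xi_density ms y s0 m0 (lt, le) \<xi>) \<partial>lborel)
        \<le> ennreal (lambda_theta_density a1 b1 \<xi>' lt * lambda_e_density ms y a2 b2 \<xi>' le) *
          ennreal (\<phi> * (1 / lt) + ?C * (1 / le) + ?D)"
    proof (cases "lt > 0 \<and> le > 0")
      case True
      then have "(\<integral>\<^sup>+\<xi>. ennreal (V \<xi>) * ennreal (xi_density ms y s0 m0 (lt, le) \<xi>) \<partial>lborel)
          \<le> ennreal (\<phi> * (1 / lt) + ?C * (1 / le) + ?D)"
        using nn_integral_V2_xi_density_le[of ms m \<phi> lt le s0 y m0] assms(5,6,8,9,20,23)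
        by (simp add: V_eq)
      then show ?thesis by (rule mult_left_mono) simp
    next
      case False
      then have "lambda_theta_density a1 b1 \<xi>' lt * lambda_e_density ms y a2 b2 \<xi>' le = 0"
        by (auto simp: lambda_theta_density_def lambda_e_density_def gamma_density_def)
      then show ?thesis by auto
    qed
  qed
  also have "\<dots> = ennreal E"
    unfolding lambda_theta_density_def lambda_e_density_def Mt K[symmetric] E_def
    using assms(1-4,7,20) M C D rates
    by (intro nn_integral_gamma_densities) auto
  finally have le_E: "(\<integral>\<^sup>+s'. ennreal (V (snd s')) \<partial>?M) \<le> ennreal E" .
  \<comment> \<open>The terms of \<open>E\<close> are compared with
    \<open>\<gamma> * V \<xi>'\<close> separately: \<delta>1 \<le> \<delta> < \<gamma> handles
    \<open>?v1\<close>, and \<delta>3 \<le> \<delta> with the condition on \<phi> handles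
    \<open>?v2 / m\<close>, whose coefficient is
    \<open>m * ?C * \<delta>2 = \<phi> * \<delta>5 + \<delta>3\<close>.\<close>
  have "\<phi> * \<delta>1 * ?v1 \<le> \<phi> * \<gamma> * ?v1"
    using assms v1_nonneg[of "theta_of \<xi>'" "mu_of \<xi>'"] by (intro mult_right_mono mult_left_mono) auto
  moreover have "(\<phi> * \<delta>5 + \<delta>3) * (?v2 / m) \<le> \<gamma> * (?v2 / m)"
    using assms v2_nonneg[of ms y "theta_of \<xi>'"] by (intro mult_right_mono) auto
  moreover have "?C * (\<delta>2 * ?v2 + c2) = (\<phi> * \<delta>5 + \<delta>3) * (?v2 / m) + ?C * c2"
    using assms(13,14) by (simp add: algebra_simps add_divide_distrib)
  moreover have "E = \<phi> * \<delta>1 * ?v1 + \<phi> * c1 + ?C * (\<delta>2 * ?v2 + c2) + ?D"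
    unfolding E_def \<delta>1 \<delta>2 by (simp add: algebra_simps)
  moreover have "\<gamma> * V \<xi>' = \<phi> * \<gamma> * ?v1 + \<gamma> * (?v2 / m)"
    by (simp add: V_eq algebra_simps)
  ultimately have E: "E \<le> \<gamma> * V \<xi>' + b"
    using assms(24) by linarith
  \<comment> \<open>\<open>ennreal\<close> truncates negative reals to 0, so carrying the bound over
    to the real integral needs \<open>E \<ge> 0\<close>.\<close>
  have E0: "E \<ge> 0"
    unfolding E_def using assms(1-4,7,20) M C D rates
    by (auto intro!: add_nonneg_nonneg mult_nonneg_nonneg divide_nonneg_nonneg sum_nonneg
        simp: v1_nonneg v2_nonneg SSE_nonneg le_max_iff_disj)
  have [measurable]: "(\<lambda>s'. V (snd s')) \<in> borel_measurable ?M"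
  proof -
    have "(snd :: (real \<times> real) \<times> (real^('k option)) \<Rightarrow> _) \<in> borel \<rightarrow>\<^sub>M borel"
      by (intro borel_measurable_continuous_onI continuous_intros)
    then have "(\<lambda>s'::(real \<times> real) \<times> (real^('k option)). V (snd s')) \<in> borel_measurable borel"
      by measurable
    then show ?thesis
      by (simp add: block_gibbs_step_def)
  qed
  \<comment> \<open>Finiteness of the nonnegative integral gives integrability, so the Bochner
    integral below is a true expectation and not the default value 0.\<close>
  have "integrable ?M (\<lambda>s'. V (snd s'))"
    using le_E by (intro integrableI_nonneg) (auto simp: V_nonneg intro: le_less_trans)
  moreover have "(\<integral>s'. V (snd s') \<partial>?M) \<le> E"
    using E0 le_E by (rule integral_real_bounded)
  ultimately show ?thesis
    using E by (simp add: V_def case_prod_beta')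
qed

end
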